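(* Let $C$ be a dendritic face complex with greatest element $\omega$, $n=\dim\omega$. Then for every $0\le k\le n$, $$C_k\setminus\{\gamma^{(k)}\omega\}=\coprod_{c\in\Lambda_{k+1}}\delta(c),$$ i.e. $C_k\setminus\{\gamma^{(k)}\omega\}$ is the union of the sets $\delta(c)$, $c\in\Lambda_{k+1}$, and these sets are pairwise disjoint.
   Context: A positive-to-one poset (POP) is a finite set $P$ with $\dim:P\to\mathbb{N}$ and binary relations $\prec^-,\prec^+$; $y\prec x$ means $y\prec^-x$ or $y\prec^+x$. Axioms: $y\prec x\Rightarrow\dim x=\dim y+1$; never both $y\prec^-x$ and $y\prec^+x$; every $x$ with $\dim x\ge1$ has exactly one $y$ with $y\prec^+x$, denoted $\gamma(x)$, and at least one $y$ with $y\prec^-x$. $\delta(x)=\{y:y\prec^-x\}$, $P_k=\dim^{-1}(k)$; $\le$ is the reflexive-transitive closure of $\prec$. A dendritic face complex is a POP such that: $(P,\le)$ has a greatest element; (oriented thinness) whenever $z\prec^{\beta}y\prec^{\alpha}x$ there is a unique $y'\ne y$ with $z\prec y'\prec x$, and writing $z\prec^{\beta'}y'\prec^{\alpha'}x$ the signs (as $\pm1$) satisfy $\alpha\beta=-\alpha'\beta'$; (acyclicity) $\delta(x)$ is a singleton if $\dim x=1$, nonempty if $\dim x\ge1$, and for $\dim x\ge1$ there are no $p\ge1$, $y_1,\dots,y_p\in\delta(x)$ with $\gamma(y_{i+1})\in\delta(y_i)$ ($1\le i<p$) and $\gamma(y_1)\in\delta(y_p)$. For $0\le k\le n$, $\gamma^{(k)}\omega:=\gamma^{n-k}(\omega)$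 (the iterated target of $\omega$ of dimension $k$). $\Lambda_k:=C_k\setminus\{\gamma(c):c\in C_{k+1}\}$ (so $\Lambda_{n+1}=\emptyset$). *)

theory Defs
  imports Main "HOL-Library.Disjoint_Sets"
begin

datatype face_sign = NegSign | PosSign

fun sign_val :: "face_sign \<Rightarrow> int" where
  "sign_val NegSign = -1"
| "sign_val PosSign = 1"

text \<open>
  \<open>sface P \<alpha> y x\<close> stands for \<open>y \<prec>\<^sup>\<alpha> x\<close>: the cell \<open>y\<close> is a facet of \<open>x\<close> of sign \<open>\<alpha>\<close>.
\<close>

record 'a signed_poset =
  carr :: "'a set"
  cdim :: "'a \<Rightarrow> nat"
  sface :: "face_sign \<Rightarrow> 'a \<Rightarrow> 'a \<Rightarrow> bool"

definition facet :: "'a signed_poset \<Rightarrow> 'a \<Rightarrow> 'a \<Rightarrow> bool" where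
  "facet P y x \<longleftrightarrow> sface P NegSign y x \<or> sface P PosSign y x"

definition face_le :: "'a signed_poset \<Rightarrow> 'a \<Rightarrow> 'a \<Rightarrow> bool" where
  "face_le P = (facet P)\<^sup>*\<^sup>*"

definition cells :: "'a signed_poset \<Rightarrow> nat \<Rightarrow> 'a set" where
  "cells P k = {x \<in> carr P. cdim P x = k}"

definition is_greatest_cell :: "'a signed_poset \<Rightarrow> 'a \<Rightarrow> bool" where
  "is_greatest_cell P w \<longleftrightarrow> w \<in> carr P \<and> (\<forall>x\<in>carr P. face_le P x w)"

text \<open>The sets \<open>\<delta>(x)\<close> and the cells \<open>\<gamma>(x)\<close>; the latter is meaningful only for
  \<open>cdim P x \<ge> 1\<close>.\<close>

definition sources :: "'a signed_poset \<Rightarrow> 'a \<Rightarrow> 'a set" where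
  "sources P x = {y. sface P NegSign y x}"

definition target :: "'a signed_poset \<Rightarrow> 'a \<Rightarrow> 'a" where
  "target P x = (THE y. sface P PosSign y x)"

text \<open>\<open>\<gamma>\<^sup>(\<^sup>k\<^sup>) x\<close>, the iterated target of dimension \<open>k\<close>, for \<open>k \<le> cdim P x\<close>.\<close>

definition iter_target :: "'a signed_poset \<Rightarrow> nat \<Rightarrow> 'a \<Rightarrow> 'a" where
  "iter_target P k x = (target P ^^ (cdim P x - k)) x"

text \<open>The set \<open>\<Lambda>\<^sub>k\<close>.\<close>

definition non_targets :: "'a signed_poset \<Rightarrow> nat \<Rightarrow> 'a set" where
  "non_targets P k = cells P k - target P ` cells P (k + 1)"

locale positive_to_one_poset =
  fixes P :: "'a signed_poset"
  assumes finite_carr: "finite (carr P)"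
    and sface_carr: "sface P \<alpha> y x \<Longrightarrow> y \<in> carr P \<and> x \<in> carr P"
    and facet_dim: "facet P y x \<Longrightarrow> cdim P x = cdim P y + 1"
    and sign_unique: "\<not> (sface P NegSign y x \<and> sface P PosSign y x)"
    and target_ex1: "x \<in> carr P \<Longrightarrow> cdim P x \<ge> 1 \<Longrightarrow> \<exists>!y. sface P PosSign y x"
    and source_ex: "x \<in> carr P \<Longrightarrow> cdim P x \<ge> 1 \<Longrightarrow> \<exists>y. sface P NegSign y x"

text \<open>
  In \<open>acyclic_sources\<close> with \<open>cdim P x = 1\<close> the cells \<open>y i\<close> have dimension 0, so that
  their targets are junk values; this is harmless because \<open>sources P (y i)\<close> is then empty.
\<close>

locale dendritic_face_complex = positive_to_one_poset +
  assumes ex_greatest: "\<exists>w. is_greatest_cell P w"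
    and thin_ex1: "sface P \<beta> z y \<Longrightarrow> sface P \<alpha> y x \<Longrightarrow>
      \<exists>!y'. y' \<noteq> y \<and> facet P z y' \<and> facet P y' x"
    and thin_signs: "sface P \<beta> z y \<Longrightarrow> sface P \<alpha> y x \<Longrightarrow>
      y' \<noteq> y \<Longrightarrow> sface P \<beta>' z y' \<Longrightarrow> sface P \<alpha>' y' x \<Longrightarrow>
      sign_val \<alpha> * sign_val \<beta> = - (sign_val \<alpha>' * sign_val \<beta>')"
    and sources_dim1: "x \<in> carr P \<Longrightarrow> cdim P x = 1 \<Longrightarrow> \<exists>y. sources P x = {y}"
    and sources_nonempty: "x \<in> carr P \<Longrightarrow> cdim P x \<ge> 1 \<Longrightarrow> sources P x \<noteq> {}"
    and acyclic_sources: "x \<in> carr P \<Longrightarrow> cdim P x \<ge> 1 \<Longrightarrow>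
      \<not> (\<exists>(p::nat) y. p \<ge> 1 \<and> (\<forall>i\<in>{1..p}. y i \<in> sources P x) \<and>
           (\<forall>i\<in>{1..<p}. target P (y (i + 1)) \<in> sources P (y i)) \<and>
           target P (y 1) \<in> sources P (y p))"

end

(*
  Oriented thinness says that each cell z of codimension 2 in x lies on exactly two chains
  z < y < x, one with sign product +1 and one with sign product -1.  Moreover, if z is a face of
  some codimension 2 cell y of x, then z is a face, with the same sign, of a source of the
  target of x: as long as y is the target of a source c of x, replace y by the source of c which
  contains z; this stops by acyclicity.

  Iterating this along w, target w, target (target w), ... shows that every cell of dimension k
  lies below the iterated target v of dimension k + 2, and then that the non-targets of dimension
  k + 1 are exactly the sources of v.  The claim thus reduces to thinness below v.
*)

theory Submission
  imports Defs
begin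

section \<open>Targets, facets and iterated targets in a positive-to-one poset\<close>

context positive_to_one_poset
begin

lemma sface_imp_facet: "sface P \<alpha> y x \<Longrightarrow> facet P y x"
  by (cases \<alpha>) (auto simp: facet_def)

lemma facet_imp_sface: "facet P y x \<Longrightarrow> \<exists>\<alpha>. sface P \<alpha> y x"
  by (auto simp: facet_def)

lemma facet_carr: "facet P y x \<Longrightarrow> y \<in> carr P \<and> x \<in> carr P"
  using sface_carr by (auto simp: facet_def)

lemma sface_pos_iff:
  assumes "x \<in> carr P" "cdim P x \<ge> 1"
  shows "sface P PosSign y x \<longleftrightarrow> y = target P x"
  using theI'[OF target_ex1[OF assms]] target_ex1[OF assms]
  unfolding target_def by blast

lemma sface_pos_imp_target:
  assumes "sface P PosSign y x"
  shows "y = target P x"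
  using assms sface_pos_iff[of x y] sface_carr[OF assms] facet_dim[OF sface_imp_facet[OF assms]]
  by simp

lemma target_facet:
  assumes "x \<in> carr P" "cdim P x \<ge> 1"
  shows "sface P PosSign (target P x) x" "target P x \<in> carr P" "cdim P x = cdim P (target P x) + 1"
proof -
  show *: "sface P PosSign (target P x) x" using sface_pos_iff[OF assms] by simp
  show "target P x \<in> carr P" using sface_carr[OF *] by simp
  show "cdim P x = cdim P (target P x) + 1" using facet_dim[OF sface_imp_facet[OF *]] .
qed

lemma facet_iff:
  assumes "x \<in> carr P" "cdim P x \<ge> 1"
  shows "facet P y x \<longleftrightarrow> y \<in> sources P x \<or> y = target P x"
  using sface_pos_iff[OF assms] by (auto simp: facet_def sources_def)

lemma target_notin_sources:
  assumes "x \<in> carr P" "cdim P x \<ge> 1"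
  shows "target P x \<notin> sources P x"
  using target_facet(1)[OF assms] sign_unique by (auto simp: sources_def)

lemma face_le_dim: "face_le P y x \<Longrightarrow> y = x \<or> cdim P y < cdim P x"
  unfolding face_le_def
  by (induction rule: rtranclp_induct) (auto dest: facet_dim)

lemma face_le_facet:
  assumes "face_le P y x" "cdim P y < cdim P x"
  obtains c where "facet P c x" "face_le P y c"
  using assms unfolding face_le_def by (metis less_irrefl rtranclp.cases)

lemma iter_target_Suc:
  assumes "k < cdim P x"
  shows "iter_target P k x = target P (iter_target P (Suc k) x)"
proof -
  have "cdim P x - k = Suc (cdim P x - Suc k)" using assms by simp
  then show ?thesis by (simp add: iter_target_def)
qed

lemma iter_target_cell:
  assumes "x \<in> carr P" "k \<le> cdim P x"
  shows "iter_target P k x \<in> carr P \<and> cdim P (iter_target P k x) = k"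
  using assms(2)
proof (induction k rule: inc_induct)
  case base
  then show ?case using assms(1) by (simp add: iter_target_def)
next
  case (step k)
  then show ?case
    using target_facet(2,3)[of "iter_target P (Suc k) x"] iter_target_Suc[of k x] by auto
qed

end

section \<open>Two-step chains, sign products and descent along sources\<close>

context dendritic_face_complex
begin

text \<open>The chain through \<open>y\<close> and the second one supplied by
  \<open>thin_ex1\<close> have opposite sign products, so one of the two has product
  \<open>s\<close>.\<close>

lemma thin_signed:
  assumes "facet P z y" "facet P y x" "s \<in> {1, -1}"
  obtains y' \<alpha> \<beta> where "sface P \<beta> z y'" "sface P \<alpha> y' x" "sign_val \<alpha> * sign_val \<beta> = s"
proof -
  obtain \<alpha> \<beta> where s: "sface P \<beta> z y" "sface P \<alpha> y x"
    using assms facet_imp_sface by blast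
  obtain y' where y': "y' \<noteq> y" "facet P z y'" "facet P y' x"
    using thin_ex1[OF s] by blast
  obtain \<alpha>' \<beta>' where s': "sface P \<beta>' z y'" "sface P \<alpha>' y' x"
    using y' facet_imp_sface by blast
  have "sign_val \<alpha> * sign_val \<beta> = - (sign_val \<alpha>' * sign_val \<beta>')"
    using thin_signs[OF s y'(1) s'] .
  moreover have "sign_val \<alpha> * sign_val \<beta> \<in> {1, -1}"
    by (cases \<alpha>; cases \<beta>) auto
  ultimately have "sign_val \<alpha> * sign_val \<beta> = s \<or> sign_val \<alpha>' * sign_val \<beta>' = s"
    using assms(3) by auto
  then show thesis using that s s' by blast
qed

text \<open>Uniqueness counterpart of \<open>thin_signed\<close>: different middle cells would give
  opposite products, and these are never zero.\<close>

lemma thin_eq: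
  assumes "sface P \<beta> z y" "sface P \<alpha> y x" "sface P \<beta>' z y'" "sface P \<alpha>' y' x"
    and "sign_val \<alpha> * sign_val \<beta> = sign_val \<alpha>' * sign_val \<beta>'"
  shows "y' = y"
proof (rule ccontr)
  assume "y' \<noteq> y"
  then have "sign_val \<alpha> * sign_val \<beta> = - (sign_val \<alpha>' * sign_val \<beta>')"
    using thin_signs assms(1-4) by blast
  with assms(5) show False by (cases \<alpha>; cases \<beta>; cases \<alpha>'; cases \<beta>'; simp)
qed

text \<open>Supplies the induction order for \<open>sface_sources_target\<close>. The relation is
  finite, and a cycle in it, read backwards, is one that \<open>acyclic_sources\<close>
  forbids.\<close>

lemma wf_source_order:
  assumes "x \<in> carr P" "cdim P x \<ge> 1"
  shows "wf {(c', c). c' \<in> sources P x \<and> c \<in> sources P x \<and> target P c' \<in> sources P c}"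
    (is "wf ?R")
proof (rule finite_acyclic_wf)
  have "sources P x \<subseteq> carr P" using sface_carr by (auto simp: sources_def)
  then have "finite (sources P x)" using finite_carr finite_subset by blast
  then show "finite ?R"
    by (intro finite_subset[of ?R "sources P x \<times> sources P x"]) auto
  show "acyclic ?R"
  proof (rule acyclicI, rule allI, rule notI)
    fix c assume "(c, c) \<in> ?R\<^sup>+"
    then obtain p where p: "p > 0" "(c, c) \<in> ?R ^^ p"
      using trancl_power by blast
    then obtain f where f: "f 0 = c" "f p = c" "\<And>i. i < p \<Longrightarrow> (f i, f (Suc i)) \<in> ?R"
      unfolding relpow_fun_conv by blast
    \<comment> \<open>The cycles of \<open>acyclic_sources\<close> are indexed from 1 and run against \<open>?R\<close>.\<close>
    define y where "y i = f (p - i)" for i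
    have step: "(y (Suc i), y i) \<in> ?R" if "i < p" for i
      using f(3)[of "p - Suc i"] that by (simp add: y_def Suc_diff_Suc)
    have "\<forall>i\<in>{1..p}. y i \<in> sources P x"
    proof
      fix i assume "i \<in> {1..p}"
      then show "y i \<in> sources P x" using step[of "i - 1"] by auto
    qed
    moreover have "\<forall>i\<in>{1..<p}. target P (y (i + 1)) \<in> sources P (y i)"
      using step by auto
    moreover have "target P (y 1) \<in> sources P (y p)"
      using step[of 0] p(1) f(1,2) by (simp add: y_def)
    ultimately show False using acyclic_sources[OF assms] p(1)
      by (metis One_nat_def Suc_leI)
  qed
qed

text \<open>Some chain from \<open>y\<close> up to \<open>x\<close> has sign product -1, hence
  exactly one positive step. The upper step being positive gives the first alternative, the lower
  one the second.\<close>

lemma source_target_or_target_source: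
  assumes "facet P y c" "facet P c x"
  shows "y \<in> sources P (target P x) \<or> (\<exists>c\<in>sources P x. y = target P c)"
proof -
  obtain c' \<alpha> \<beta> where c': "sface P \<beta> y c'" "sface P \<alpha> c' x" "sign_val \<alpha> * sign_val \<beta> = -1"
    by (rule thin_signed[OF assms, of "-1"]) (simp, blast)
  then show ?thesis
    by (cases \<alpha>; cases \<beta>) (auto simp: sources_def dest!: sface_pos_imp_target)
qed

lemma sface_sources_target:
  assumes "sface P \<beta> z y" "facet P y c" "facet P c x"
  shows "\<exists>y'\<in>sources P (target P x). sface P \<beta> z y'"
proof -
  have x: "x \<in> carr P" "cdim P x \<ge> 2"
    using facet_carr[OF assms(3)] facet_dim[OF assms(2)] facet_dim[OF assms(3)] by auto
  then have x1: "cdim P x \<ge> 1" by simp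
  have descend: "\<exists>y'\<in>sources P (target P x). sface P \<beta> z y'"
    if "c \<in> sources P x" "sface P \<beta> z (target P c)" for c
    using wf_source_order[OF x(1) x1] that
  proof (induction c rule: wf_induct_rule)
    case (less c)
    have cx: "sface P NegSign c x" using less.prems by (simp add: sources_def)
    have tc: "sface P PosSign (target P c) c"
      using target_facet(1)[of c] sface_carr[OF cx] facet_dim[OF sface_imp_facet[OF cx]] x by simp
    obtain y' where y': "y' \<noteq> target P c" "facet P z y'" "facet P y' c"
      using thin_ex1[OF less.prems(2) tc] by blast
    obtain \<beta>' where z': "sface P \<beta>' z y'" using facet_imp_sface[OF y'(2)] by blast
    have y'c: "sface P NegSign y' c"
      using y'(1,3) sface_pos_imp_target by (auto simp: facet_def)
    \<comment> \<open>In \<open>c\<close> the cell \<open>target P c\<close> is positive and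
      \<open>y'\<close> negative; this change of sign cancels the minus sign of oriented
      thinness.\<close>
    have "sign_val \<beta> = sign_val \<beta>'"
      using thin_signs[OF less.prems(2) tc y'(1) z' y'c] by simp
    then have zy': "sface P \<beta> z y'" using z' by (cases \<beta>; cases \<beta>') auto
    consider "y' \<in> sources P (target P x)" | c' where "c' \<in> sources P x" "y' = target P c'"
      using source_target_or_target_source[OF sface_imp_facet[OF y'c] sface_imp_facet[OF cx]]
      by blast
    then show ?case
    proof cases
      case 1
      then show ?thesis using zy' by blast
    next
      case 2
      \<comment> \<open>Here \<open>target P c' = y'\<close> is a source of \<open>c\<close>, so
        \<open>c'\<close> precedes \<open>c\<close> in the well-founded order.\<close>
      then show ?thesis using less.IH[of c'] less.prems y'c zy' by (auto simp: sources_def)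
    qed
  qed
  show ?thesis
    using source_target_or_target_source[OF assms(2,3)] descend assms(1) by blast
qed

text \<open>Chains of sign product 1 are either negative twice or positive twice, and the latter end
  only at \<open>target P (target P x)\<close>. By \<open>thin_eq\<close> no cell is reached in both
  ways, since the middle cell would be a source and the target of \<open>x\<close>.\<close>

lemma codim2_minus_iterated_target:
  assumes "x \<in> carr P" "cdim P x \<ge> 2"
  shows "{z. \<exists>y. facet P z y \<and> facet P y x} - {target P (target P x)}
    = (\<Union>y\<in>sources P x. sources P y)"
proof (intro equalityI subsetI)
  fix z assume z: "z \<in> {z. \<exists>y. facet P z y \<and> facet P y x} - {target P (target P x)}"
  then obtain c where c: "facet P z c" "facet P c x" by blast
  obtain y \<alpha> \<beta> where y: "sface P \<beta> z y" "sface P \<alpha> y x" "sign_val \<alpha> * sign_val \<beta> = 1"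
    by (rule thin_signed[OF c, of 1]) (simp, blast)
  then show "z \<in> (\<Union>y\<in>sources P x. sources P y)"
    using z by (cases \<alpha>; cases \<beta>) (auto simp: sources_def dest!: sface_pos_imp_target)
next
  fix z assume "z \<in> (\<Union>y\<in>sources P x. sources P y)"
  then obtain y where y: "sface P NegSign y x" "sface P NegSign z y" by (auto simp: sources_def)
  note tx = target_facet[OF assms(1)]
  have t: "sface P PosSign (target P x) x" using tx(1) assms(2) by simp
  have tt: "sface P PosSign (target P (target P x)) (target P x)"
    using target_facet(1)[of "target P x"] tx assms(2) by simp
  have "z \<noteq> target P (target P x)"
    using thin_eq[OF y(2,1) _ t, of PosSign] tt t y(1) sign_unique by auto
  then show "z \<in> {z. \<exists>y. facet P z y \<and> facet P y x} - {target P (target P x)}"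
    using y sface_imp_facet by blast
qed

lemma disjoint_sources_sources: "disjoint_family_on (sources P) (sources P x)"
  unfolding disjoint_family_on_def
proof (intro ballI impI)
  fix y y' assume "y \<in> sources P x" "y' \<in> sources P x" "y \<noteq> y'"
  then show "sources P y \<inter> sources P y' = {}"
    using thin_eq[of NegSign _ y NegSign x NegSign y' NegSign] by (auto simp: sources_def)
qed

text \<open>The chains through \<open>target P x\<close> and through \<open>c\<close> would both
  have sign product -1, forcing \<open>c = target P x\<close>.\<close>

lemma source_target_not_target_source:
  assumes "x \<in> carr P" "cdim P x \<ge> 1" "y \<in> sources P (target P x)" "c \<in> sources P x"
  shows "\<not> sface P PosSign y c"
proof
  assume "sface P PosSign y c"
  then have "c = target P x"
    using thin_eq[of NegSign y "target P x" PosSign x PosSign c NegSign] assms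
      target_facet(1)[OF assms(1,2)] by (simp add: sources_def)
  then show False using target_notin_sources[OF assms(1,2)] assms(4) by simp
qed

section \<open>Cells below the iterated targets of the greatest cell\<close>

lemma face_le_iter_target:
  assumes "is_greatest_cell P w" "z \<in> carr P" "cdim P z + 2 \<le> m" "m \<le> cdim P w"
  shows "face_le P z (iter_target P m w)"
  using assms(4,3)
proof (induction m rule: inc_induct)
  case base
  then show ?case using assms(1,2) by (simp add: iter_target_def is_greatest_cell_def)
next
  case (step m)
  let ?v = "iter_target P (Suc m) w"
  have v: "cdim P ?v = Suc m"
    using iter_target_cell[of w "Suc m"] step.hyps assms(1) by (simp add: is_greatest_cell_def)
  have "face_le P z ?v" using step by simp
  then obtain c where c: "facet P c ?v" "face_le P z c"
    using face_le_facet[of z ?v] v step.prems by auto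
  have cd: "cdim P c = m" using facet_dim[OF c(1)] v by simp
  obtain y where y: "facet P y c" "face_le P z y"
    using face_le_facet[OF c(2)] cd step.prems by auto
  have yd: "cdim P y = m - 1" using facet_dim[OF y(1)] cd by simp
  \<comment> \<open>The gap of 2 leaves room for a third step down from \<open>?v\<close>, to a cell
    \<open>z'\<close> of dimension \<open>m - 2\<close> still above \<open>z\<close>.\<close>
  have zd: "cdim P z < m - 1" using step.prems by simp
  obtain z' where z': "facet P z' y" "face_le P z z'"
    using face_le_facet[OF y(2)] yd zd by auto
  obtain \<beta> where \<beta>: "sface P \<beta> z' y" using facet_imp_sface[OF z'(1)] by blast
  \<comment> \<open>Exchanging \<open>y\<close> for a source of \<open>target P ?v\<close> keeps the
    part of the chain from \<open>z\<close> to \<open>z'\<close>.\<close>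
  obtain y' where y': "y' \<in> sources P (target P ?v)" "sface P \<beta> z' y'"
    using sface_sources_target[OF \<beta> y(1) c(1)] by blast
  have "facet P y' (target P ?v)" "facet P z' y'"
    using y' sface_imp_facet by (auto simp: sources_def)
  then have "face_le P z (target P ?v)"
    using z'(2) unfolding face_le_def by (meson rtranclp.rtrancl_into_rtrancl)
  then show ?case using iter_target_Suc[of m w] step.hyps by simp
qed

lemma cell_codim2_iter_target:
  assumes "is_greatest_cell P w" "z \<in> carr P" "cdim P z + 2 \<le> cdim P w"
  obtains y where "facet P z y" "facet P y (iter_target P (cdim P z + 2) w)"
proof -
  let ?v = "iter_target P (cdim P z + 2) w"
  have v: "cdim P ?v = cdim P z + 2"
    using iter_target_cell assms by (simp add: is_greatest_cell_def)
  have "face_le P z ?v" using face_le_iter_target assms by simp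
  then obtain y where y: "facet P y ?v" "face_le P z y"
    using face_le_facet[of z ?v] v by auto
  have yd: "cdim P y = cdim P z + 1" using facet_dim[OF y(1)] v by simp
  obtain z' where z': "facet P z' y" "face_le P z z'"
    using face_le_facet[OF y(2)] yd by auto
  have "z' = z" using face_le_dim[OF z'(2)] facet_dim[OF z'(1)] yd by auto
  then show thesis using that y(1) z'(1) by blast
qed

section \<open>The top dimensions, the non-targets and the decomposition\<close>

lemma cells_greatest:
  assumes "is_greatest_cell P w"
  shows "cells P (cdim P w) = {w}"
  using assms face_le_dim[of _ w] by (fastforce simp: is_greatest_cell_def cells_def)

lemma cells_Suc_greatest:
  assumes "is_greatest_cell P w"
  shows "cells P (cdim P w + 1) = {}"
  using assms face_le_dim[of _ w] by (fastforce simp: is_greatest_cell_def cells_def)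

lemma cells_facets_greatest:
  assumes "is_greatest_cell P w" "cdim P w = Suc k"
  shows "cells P k = {y. facet P y w}"
proof (intro equalityI subsetI)
  fix y assume "y \<in> cells P k"
  then have y: "face_le P y w" "cdim P y = k"
    using assms(1) by (auto simp: is_greatest_cell_def cells_def)
  obtain c where c: "facet P c w" "face_le P y c" using face_le_facet[OF y(1)] y(2) assms(2) by auto
  then have "y = c" using face_le_dim[OF c(2)] facet_dim[OF c(1)] y(2) assms(2) by auto
  then show "y \<in> {y. facet P y w}" using c by simp
next
  fix y assume "y \<in> {y. facet P y w}"
  then show "y \<in> cells P k" using facet_carr facet_dim assms(2) by (fastforce simp: cells_def)
qed

text \<open>Since \<open>?v\<close> is the target of the iterated target \<open>?u\<close> one
  dimension higher, a cell of dimension \<open>k\<close> is a source of \<open>?v\<close> or the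
  target of a source of \<open>?u\<close>. Conversely, a source of \<open>?v\<close> that is a
  target at all would also be the target of a source of \<open>?u\<close>, which
  \<open>source_target_not_target_source\<close> excludes. Near the top, where these iterated
  targets run out, the facets of \<open>w\<close> are used directly.\<close>

lemma non_targets_eq_sources:
  assumes g: "is_greatest_cell P w" and k: "Suc k \<le> cdim P w"
  shows "non_targets P k = sources P (iter_target P (Suc k) w)"
proof -
  let ?v = "iter_target P (Suc k) w"
  have wc: "w \<in> carr P" using g by (simp add: is_greatest_cell_def)
  have v: "?v \<in> carr P" "cdim P ?v = Suc k" using iter_target_cell[OF wc k] by auto
  show ?thesis
  proof (intro equalityI subsetI)
    fix y assume "y \<in> non_targets P k"
    then have y: "y \<in> carr P" "cdim P y = k" "y \<notin> target P ` cells P (k + 1)"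
      by (auto simp: non_targets_def cells_def)
    show "y \<in> sources P ?v"
    proof (cases "cdim P w = Suc k")
      case True
      have "?v = w" using True by (simp add: iter_target_def)
      moreover have "facet P y w"
        using cells_facets_greatest[OF g True] y by (auto simp: cells_def)
      moreover have "y \<noteq> target P w" using y(3) True wc by (auto simp: cells_def)
      ultimately show ?thesis using facet_iff[OF wc] True by auto
    next
      case False
      then have k2: "k + 2 \<le> cdim P w" using k by simp
      let ?u = "iter_target P (k + 2) w"
      have u: "?u \<in> carr P" "cdim P ?u = k + 2" using iter_target_cell[OF wc k2] by auto
      have vu: "?v = target P ?u" using iter_target_Suc[of "Suc k" w] k2 by simp
      obtain c where "facet P y c" "facet P c ?u"
        using cell_codim2_iter_target[OF g y(1)] y(2) k2 by auto
      then consider "y \<in> sources P ?v" | c where "c \<in> sources P ?u" "y = target P c"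
        using source_target_or_target_source vu by metis
      then show ?thesis
      proof cases
        case 2
        then have "c \<in> cells P (k + 1)"
          using sface_carr facet_dim[of c ?u] u(2)
          by (fastforce simp: sources_def cells_def facet_def)
        then show ?thesis using 2 y(3) by blast
      qed
    qed
  next
    fix y assume y: "y \<in> sources P ?v"
    then have yv: "sface P NegSign y ?v" by (simp add: sources_def)
    have "y \<in> cells P k"
      using sface_carr[OF yv] facet_dim[OF sface_imp_facet[OF yv]] v by (simp add: cells_def)
    moreover have False if c: "c \<in> cells P (k + 1)" "y = target P c" for c
    proof -
      have cc: "c \<in> carr P" "cdim P c = k + 1" using c(1) by (auto simp: cells_def)
      have yc: "sface P PosSign y c" using target_facet(1)[of c] cc c(2) by simp
      have cv: "c \<noteq> ?v" using yc yv sign_unique by blast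
      \<comment> \<open>If \<open>w\<close> had dimension \<open>Suc k\<close>, then
        \<open>?v = w\<close> would be the only cell of that dimension, against
        \<open>c \<noteq> ?v\<close>.\<close>
      then have k2: "k + 2 \<le> cdim P w"
        using cells_greatest[OF g] c(1) k by (cases "cdim P w = Suc k") (auto simp: iter_target_def)
      let ?u = "iter_target P (k + 2) w"
      have u: "?u \<in> carr P" "cdim P ?u \<ge> 1" using iter_target_cell[OF wc k2] by auto
      have vu: "?v = target P ?u" using iter_target_Suc[of "Suc k" w] k2 by simp
      \<comment> \<open>The cell \<open>c\<close> need not lie below \<open>?u\<close>; it is traded
        for a source of \<open>?u\<close> with the same target \<open>y\<close>.\<close>
      have "\<exists>c'\<in>sources P ?u. sface P PosSign y c'"
      proof (cases "cdim P w = k + 2")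
        case True
        then have "?u = w" by (simp add: iter_target_def)
        moreover have "facet P c w" using cells_facets_greatest[OF g, of "k + 1"] True c(1) by auto
        ultimately show ?thesis using facet_iff[OF u] cv vu yc by auto
      next
        case False
        then have k3: "k + 3 \<le> cdim P w" using k2 by simp
        have "?u = target P (iter_target P (k + 3) w)"
          using iter_target_Suc[of "k + 2" w] k3 by (simp add: numeral_3_eq_3)
        moreover obtain b where "facet P c b" "facet P b (iter_target P (k + 3) w)"
          using cell_codim2_iter_target[OF g cc(1)] cc(2) k3 by (auto simp: numeral_eq_Suc)
        \<comment> \<open>Sign preservation in \<open>sface_sources_target\<close> is essential
          here: \<open>y\<close> stays a positive facet.\<close>
        ultimately show ?thesis using sface_sources_target[OF yc] by simp
      qed
      then show False using source_target_not_target_source[OF u] y vu by auto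
    qed
    ultimately show "y \<in> non_targets P k" by (auto simp: non_targets_def)
  qed
qed

text \<open>From codimension 2 on, the cells of dimension \<open>k\<close> are those of codimension
  2 in \<open>?v\<close>, and the non-targets are its sources, so thinness below \<open>?v\<close>
  gives both claims. For \<open>k = cdim P w\<close> both sides are empty; one dimension lower,
  \<open>w\<close> is the only non-target.\<close>

lemma cells_minus_iter_target:
  assumes g: "is_greatest_cell P w" and "k \<le> cdim P w"
  shows "cells P k - {iter_target P k w} = (\<Union>c\<in>non_targets P (k + 1). sources P c)
    \<and> disjoint_family_on (sources P) (non_targets P (k + 1))"
proof -
  have wc: "w \<in> carr P" using g by (simp add: is_greatest_cell_def)
  consider "cdim P w = k" | "cdim P w = Suc k" | "k + 2 \<le> cdim P w" using assms(2) by linarith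
  then show ?thesis
  proof cases
    case 1
    then have "non_targets P (k + 1) = {}"
      using cells_Suc_greatest[OF g] by (simp add: non_targets_def)
    then show ?thesis
      using cells_greatest[OF g] 1 by (simp add: iter_target_def disjoint_family_on_def)
  next
    case 2
    then have "non_targets P (k + 1) = {w}"
      using cells_Suc_greatest[OF g] cells_greatest[OF g] by (simp add: non_targets_def)
    moreover have "cells P k - {target P w} = sources P w"
      using cells_facets_greatest[OF g 2] facet_iff[OF wc] target_notin_sources[OF wc] 2 by auto
    ultimately show ?thesis using 2 by (simp add: iter_target_def disjoint_family_on_def)
  next
    case 3
    let ?v = "iter_target P (k + 2) w"
    have v: "?v \<in> carr P" "cdim P ?v = k + 2" using iter_target_cell[OF wc 3] by auto
    have "cells P k = {z. \<exists>y. facet P z y \<and> facet P y ?v}"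
    proof (intro equalityI subsetI)
      fix z assume "z \<in> cells P k"
      then show "z \<in> {z. \<exists>y. facet P z y \<and> facet P y ?v}"
        using cell_codim2_iter_target[OF g, of z] 3 by (auto simp: cells_def)
    next
      fix z assume "z \<in> {z. \<exists>y. facet P z y \<and> facet P y ?v}"
      then obtain y where "facet P z y" "facet P y ?v" by blast
      then show "z \<in> cells P k"
        using facet_carr[of z y] facet_dim[of z y] facet_dim[of y ?v] v by (simp add: cells_def)
    qed
    moreover have "iter_target P k w = target P (target P ?v)"
      using iter_target_Suc[of k w] iter_target_Suc[of "Suc k" w] 3 by simp
    moreover have "non_targets P (k + 1) = sources P ?v"
      using non_targets_eq_sources[OF g, of "k + 1"] 3 by simp
    ultimately show ?thesis
      using codim2_minus_iterated_target[OF v(1)] disjoint_sources_sources v(2) by simp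
  qed
qed

end

theorem mainTheorem5:
  fixes C :: "'a signed_poset" and \<omega> :: 'a and n k :: nat
  assumes "dendritic_face_complex C"
    and "is_greatest_cell C \<omega>"
    and "n = cdim C \<omega>"
    and "k \<le> n"
  shows "cells C k - {iter_target C k \<omega>} = (\<Union>c\<in>non_targets C (k + 1). sources C c)
    \<and> disjoint_family_on (sources C) (non_targets C (k + 1))"
  using dendritic_face_complex.cells_minus_iter_target[OF assms(1,2)] assms(3,4) by simp

end
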